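(* Let $\mathcal{C}\subseteq\mathbb{S}_n$ be a code and suppose that $\mathrm{d}_\mathrm{K}(\mathcal{C})>\binom{t}{2}$ for some $t\in[n]$. Then $|\mathcal{C}|\le \frac{n!}{t!}$.
   Context: $\mathbb{S}_n$ is the group of permutations of $[n]=\{1,\dots,n\}$, written in one-line notation. The Kendall-$\tau$ distance $\mathrm{d}_\mathrm{K}(\sigma,\tau)$ is the minimum number of adjacent transpositions (swaps of two consecutive entries in one-line notation) needed to obtain $\sigma$ from $\tau$. A code is a subset $\mathcal{C}\subseteq\mathbb{S}_n$ with $|\mathcal{C}|\ge 2$; its minimum distance is $\mathrm{d}_\mathrm{K}(\mathcal{C})=\min\{\mathrm{d}_\mathrm{K}(\sigma,\tau):\sigma,\tau\in\mathcal{C},\ \sigma\neq\tau\}$. *)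

theory Defs
  imports Complex_Main "HOL-Combinatorics.Permutations"
begin

text \<open>A permutation is a function \<open>\<sigma>\<close> with \<open>\<sigma> permutes {1..n}\<close>; its one-line notation is
  \<open>\<sigma> 1, \<dots>, \<sigma> n\<close>. Exchanging the entries in positions \<open>i\<close> and \<open>i + 1\<close> is composition with
  the transposition on the right.\<close>

definition adj_swap :: "nat \<Rightarrow> (nat \<Rightarrow> nat) \<Rightarrow> (nat \<Rightarrow> nat) \<Rightarrow> bool" where
  "adj_swap n \<sigma> \<tau> \<longleftrightarrow> (\<exists>i\<in>{1..<n}. \<tau> = \<sigma> \<circ> transpose i (Suc i))"

definition kendall_dist :: "nat \<Rightarrow> (nat \<Rightarrow> nat) \<Rightarrow> (nat \<Rightarrow> nat) \<Rightarrow> nat" where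
  "kendall_dist n \<sigma> \<tau> = (LEAST k. (adj_swap n ^^ k) \<tau> \<sigma>)"

definition is_code :: "nat \<Rightarrow> (nat \<Rightarrow> nat) set \<Rightarrow> bool" where
  "is_code n C \<longleftrightarrow> C \<subseteq> {\<sigma>. \<sigma> permutes {1..n}} \<and> card C \<ge> 2"

definition min_kendall_dist :: "nat \<Rightarrow> (nat \<Rightarrow> nat) set \<Rightarrow> nat" where
  "min_kendall_dist n C = Min {kendall_dist n \<sigma> \<tau> | \<sigma> \<tau>. \<sigma> \<in> C \<and> \<tau> \<in> C \<and> \<sigma> \<noteq> \<tau>}"

end

theory Submission
  imports Defs
begin

text \<open>Any two elements of a left coset of the subgroup of permutations of \<open>{1..t}\<close> are at distance
  at most \<open>t choose 2\<close>, by insertion sort. Hence each of these cosets, of size \<open>t!\<close>, contains at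
  most one codeword.\<close>

text \<open>One pass of the insertion sort: swaps push the entry \<open>Suc t\<close> of \<rho>
  rightwards from position \<open>j\<close> to position \<open>Suc t\<close>, leaving a permutation
  of \<open>{1..t}\<close>. Swaps act on the right, so an arbitrary \<sigma> on the left is carried
  along unchanged. The induction runs downwards from \<open>j = Suc t\<close>.\<close>

lemma adj_swap_relpowp_move_max:
  assumes "j \<le> Suc t" "1 \<le> j" "Suc t \<le> n" "\<rho> permutes {1..Suc t}" "\<rho> j = Suc t"
  shows "\<exists>\<rho>'. \<rho>' permutes {1..t} \<and> (adj_swap n ^^ (Suc t - j)) (\<sigma> \<circ> \<rho>') (\<sigma> \<circ> \<rho>)"
  using assms
proof (induction arbitrary: \<rho> rule: inc_induct)
  case base
  have "\<rho> permutes {1..t}"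
    by (rule permutes_superset[OF base(3)]) (use base(4) in \<open>auto simp: le_Suc_eq\<close>)
  then show ?case by auto
next
  case (step j)
  let ?s = "transpose j (Suc j)"
  have "?s permutes {1..Suc t}"
    using step.hyps step.prems by (intro permutes_swap_id) auto
  then have "\<rho> \<circ> ?s permutes {1..Suc t}"
    using step.prems by (intro permutes_compose)
  moreover have "(\<rho> \<circ> ?s) (Suc j) = Suc t"
    using step.prems by simp
  ultimately obtain \<rho>' where \<rho>': "\<rho>' permutes {1..t}"
    and path: "(adj_swap n ^^ (Suc t - Suc j)) (\<sigma> \<circ> \<rho>') (\<sigma> \<circ> (\<rho> \<circ> ?s))"
    using step.IH[of "\<rho> \<circ> ?s"] step.prems le_SucI by blast
  \<comment> \<open>As \<open>?s\<close> is an involution, the swap that moves \<open>Suc t\<close>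
    one place to the right can be undone; the undoing swap becomes the last step of the path to
    \<open>\<sigma> \<circ> \<rho>\<close>.\<close>
  have "\<sigma> \<circ> \<rho> = \<sigma> \<circ> (\<rho> \<circ> ?s) \<circ> ?s"
    by (simp add: fun_eq_iff)
  then have "adj_swap n (\<sigma> \<circ> (\<rho> \<circ> ?s)) (\<sigma> \<circ> \<rho>)"
    unfolding adj_swap_def using step.hyps step.prems by (intro bexI[of _ j]) auto
  with path have "(adj_swap n ^^ Suc (Suc t - Suc j)) (\<sigma> \<circ> \<rho>') (\<sigma> \<circ> \<rho>)"
    by (auto intro: relpowp_Suc_I)
  moreover have "Suc (Suc t - Suc j) = Suc t - j"
    using step.hyps by simp
  ultimately show ?case using \<rho>' by metis
qed

text \<open>Passes for the entries \<open>t\<close>, \<open>t - 1\<close>, ..., 1 reduce \<rho> to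
  the identity and cost at most \<open>t - 1\<close>, \<open>t - 2\<close>, ..., 0 swaps, which sum
  to \<open>t choose 2\<close>.\<close>

lemma adj_swap_relpowp_compose:
  assumes "\<rho> permutes {1..t}" "t \<le> n"
  shows "\<exists>k \<le> t choose 2. (adj_swap n ^^ k) \<sigma> (\<sigma> \<circ> \<rho>)"
  using assms
proof (induction t arbitrary: \<rho>)
  case 0
  then have "\<rho> = id" by simp
  then show ?case by (auto intro!: exI[of _ 0])
next
  case (Suc t)
  define j where "j = inv \<rho> (Suc t)"
  have j: "\<rho> j = Suc t" "j \<in> {1..Suc t}"
    using permutes_inverses(1)[OF Suc.prems(1)] permutes_in_image[OF permutes_inv[OF Suc.prems(1)]]
    by (auto simp: j_def)
  obtain \<rho>' where \<rho>': "\<rho>' permutes {1..t}"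
    and path: "(adj_swap n ^^ (Suc t - j)) (\<sigma> \<circ> \<rho>') (\<sigma> \<circ> \<rho>)"
    using adj_swap_relpowp_move_max[of j t n \<rho> \<sigma>] j Suc.prems by auto
  obtain k where k: "k \<le> t choose 2" "(adj_swap n ^^ k) \<sigma> (\<sigma> \<circ> \<rho>')"
    using Suc.IH[OF \<rho>'] Suc_leD[OF Suc.prems(2)] by blast
  have "(adj_swap n ^^ (k + (Suc t - j))) \<sigma> (\<sigma> \<circ> \<rho>)"
    using k(2) path by (auto simp: relpowp_add)
  \<comment> \<open>Since \<open>j\<close> is at least 1, the pass costs at most \<open>t\<close>
    swaps, and Pascal's rule gives \<open>(t choose 2) + t = Suc t choose 2\<close>.\<close>
  moreover have "k + (Suc t - j) \<le> Suc t choose 2"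
    using k(1) j(2) by (auto simp: numeral_2_eq_2)
  ultimately show ?case by blast
qed

lemma kendall_dist_compose_le:
  assumes "\<rho> permutes {1..t}" "t \<le> n"
  shows "kendall_dist n (\<sigma> \<circ> \<rho>) \<sigma> \<le> t choose 2"
proof -
  obtain k where "k \<le> t choose 2" "(adj_swap n ^^ k) \<sigma> (\<sigma> \<circ> \<rho>)"
    using adj_swap_relpowp_compose[OF assms] by blast
  then show ?thesis
    unfolding kendall_dist_def by (meson Least_le le_trans)
qed

lemma min_kendall_dist_le:
  assumes "finite C" "\<sigma> \<in> C" "\<tau> \<in> C" "\<sigma> \<noteq> \<tau>"
  shows "min_kendall_dist n C \<le> kendall_dist n \<sigma> \<tau>"
proof -
  have "{kendall_dist n \<sigma> \<tau> | \<sigma> \<tau>. \<sigma> \<in> C \<and> \<tau> \<in> C \<and> \<sigma> \<noteq> \<tau>}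
      \<subseteq> (\<lambda>(\<sigma>, \<tau>). kendall_dist n \<sigma> \<tau>) ` (C \<times> C)"
    by auto
  then have "finite {kendall_dist n \<sigma> \<tau> | \<sigma> \<tau>. \<sigma> \<in> C \<and> \<tau> \<in> C \<and> \<sigma> \<noteq> \<tau>}"
    by (rule finite_subset) (simp add: assms(1))
  then show ?thesis
    unfolding min_kendall_dist_def by (rule Min_le) (use assms in blast)
qed

theorem theorem3p8:
  fixes n t :: nat and C :: "(nat \<Rightarrow> nat) set"
  assumes "is_code n C"
    and "t \<in> {1..n}"
    and "min_kendall_dist n C > t choose 2"
  shows "real (card C) \<le> fact n / fact t"
proof -
  \<comment> \<open>An infinite set has \<open>card\<close> 0, so \<open>card C \<ge> 2\<close>
    forces finiteness.\<close>
  have C: "\<And>\<sigma>. \<sigma> \<in> C \<Longrightarrow> \<sigma> permutes {1..n}"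
    and fin: "finite C"
    using assms(1) unfolding is_code_def by (auto intro: card_ge_0_finite)
  have t: "t \<le> n" using assms(2) by simp
  define H where "H = {\<rho>. \<rho> permutes {1..t}}"
  \<comment> \<open>Injectivity packages two facts: cosets of \<open>H\<close> through distinct
    codewords are disjoint, and each has as many elements as \<open>H\<close>.\<close>
  have inj: "inj_on (\<lambda>(\<sigma>, \<rho>). \<sigma> \<circ> \<rho>) (C \<times> H)"
  proof (rule inj_onI, clarify)
    fix \<sigma> \<rho> \<sigma>' \<rho>'
    assume *: "\<sigma> \<in> C" "\<sigma>' \<in> C" "\<rho> \<in> H" "\<rho>' \<in> H" and eq: "\<sigma> \<circ> \<rho> = \<sigma>' \<circ> \<rho>'"
    have \<rho>: "\<rho> permutes {1..t}" "\<rho>' permutes {1..t}" using * by (auto simp: H_def)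
    have "\<sigma> = \<sigma> \<circ> \<rho> \<circ> inv \<rho>"
      by (simp add: comp_assoc permutes_inv_o[OF \<rho>(1)])
    also have "\<dots> = \<sigma>' \<circ> (\<rho>' \<circ> inv \<rho>)"
      by (simp add: eq comp_assoc)
    finally have "\<sigma> = \<sigma>' \<circ> (\<rho>' \<circ> inv \<rho>)" .
    \<comment> \<open>Here \<sigma> and \<sigma>' lie in the same left coset of \<open>H\<close>,
      which is too close for distinct codewords.\<close>
    then have "kendall_dist n \<sigma> \<sigma>' \<le> t choose 2"
      using kendall_dist_compose_le[OF permutes_compose[OF permutes_inv[OF \<rho>(1)] \<rho>(2)] t]
      by metis
    then have "\<sigma> = \<sigma>'"
      using min_kendall_dist_le[OF fin *(1,2)] assms(3) by (meson leD le_trans)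
    moreover from this have "\<rho> = \<rho>'"
      using eq permutes_inj[OF C[OF *(1)]] by (metis fun.inj_map injD)
    ultimately show "\<sigma> = \<sigma>' \<and> \<rho> = \<rho>'" ..
  qed
  have "(\<lambda>(\<sigma>, \<rho>). \<sigma> \<circ> \<rho>) ` (C \<times> H) \<subseteq> {\<sigma>. \<sigma> permutes {1..n}}"
    using C t by (auto simp: H_def intro!: permutes_compose intro: permutes_subset)
  then have "card (C \<times> H) \<le> card {\<sigma>. \<sigma> permutes {1..n}}"
    by (intro card_inj_on_le[OF inj]) (auto simp: finite_permutations)
  then have "card C * fact t \<le> (fact n :: nat)"
    by (simp add: H_def card_cartesian_product card_permutations)
  then have "real (card C) * fact t \<le> fact n"
    by (metis of_nat_fact of_nat_le_iff of_nat_mult)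
  then show ?thesis by (simp add: field_simps)
qed

end
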